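(* For all integers $r,s\geq 2$, the complete bipartite graph $K_{2r,2s}$ is doubly Eulerian.
   Context: An Eulerian circuit is a closed trail traversing every edge exactly once. Let $G$ be Eulerian with $m$ edges and $u$ a vertex. Two Eulerian circuits $u,v_1,\ldots,v_{m-1},u$ and $u,w_1,\ldots,w_{m-1},u$ are avoiding if for every $1\le i\le m-1$, $v_i\neq w_i$ and $v_i$ is not adjacent to $w_i$. $G$ is doubly Eulerian if it is Eulerian and for every vertex $u$ there is a pair of avoiding Eulerian circuits starting and ending at $u$. *)

theory Defs
  imports Main
begin

record 'a graph =
  verts :: "'a set"
  edges :: "'a set set"

definition finite_simple_graph :: "'a graph \<Rightarrow> bool" where
  "finite_simple_graph G \<longleftrightarrow>
     finite (verts G) \<and> (\<forall>e \<in> edges G. e \<subseteq> verts G \<and> card e = 2)"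

definition adjacent :: "'a graph \<Rightarrow> 'a \<Rightarrow> 'a \<Rightarrow> bool" where
  "adjacent G x y \<longleftrightarrow> {x, y} \<in> edges G"

text \<open>Walks are given by their nonempty vertex sequences; in a simple graph this
  determines the edges traversed.\<close>

definition walk_edges :: "'a list \<Rightarrow> 'a set list" where
  "walk_edges xs = map2 (\<lambda>x y. {x, y}) xs (tl xs)"

definition walk :: "'a graph \<Rightarrow> 'a list \<Rightarrow> bool" where
  "walk G xs \<longleftrightarrow> xs \<noteq> [] \<and> set xs \<subseteq> verts G \<and> set (walk_edges xs) \<subseteq> edges G"

definition closed_trail :: "'a graph \<Rightarrow> 'a list \<Rightarrow> bool" where
  "closed_trail G xs \<longleftrightarrow> walk G xs \<and> distinct (walk_edges xs) \<and> hd xs = last xs"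

definition eulerian_circuit :: "'a graph \<Rightarrow> 'a list \<Rightarrow> bool" where
  "eulerian_circuit G xs \<longleftrightarrow> closed_trail G xs \<and> set (walk_edges xs) = edges G"

definition eulerian :: "'a graph \<Rightarrow> bool" where
  "eulerian G \<longleftrightarrow> finite_simple_graph G \<and> (\<exists>xs. eulerian_circuit G xs)"

text \<open>An Eulerian circuit of a graph with \<open>m\<close> edges is a list of length \<open>m + 1\<close>, whose
  positions \<open>0\<close> and \<open>m\<close> both hold the base vertex \<open>u\<close>; the avoidance condition
  concerns the positions \<open>1, \<dots>, m - 1\<close>.\<close>

definition avoiding :: "'a graph \<Rightarrow> 'a \<Rightarrow> 'a list \<Rightarrow> 'a list \<Rightarrow> bool" where
  "avoiding G u xs ys \<longleftrightarrow>
     eulerian_circuit G xs \<and> hd xs = u \<and>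
     eulerian_circuit G ys \<and> hd ys = u \<and>
     (\<forall>i. 1 \<le> i \<and> i \<le> card (edges G) - 1 \<longrightarrow>
        xs ! i \<noteq> ys ! i \<and> \<not> adjacent G (xs ! i) (ys ! i))"

definition doubly_eulerian :: "'a graph \<Rightarrow> bool" where
  "doubly_eulerian G \<longleftrightarrow>
     eulerian G \<and> (\<forall>u \<in> verts G. \<exists>xs ys. avoiding G u xs ys)"

definition complete_bipartite :: "nat \<Rightarrow> nat \<Rightarrow> (nat + nat) graph" where
  "complete_bipartite m n =
     \<lparr> verts = Inl ` {..<m} \<union> Inr ` {..<n},
       edges = {{Inl i, Inr j} | i j. i < m \<and> j < n} \<rparr>"

end

theory Submission
  imports Defs "HOL-Combinatorics.Transposition"
begin

text \<open>
  Two walks in a bipartite graph that start at the same vertex are on the same side at every time,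
  so only \<open>v\<^sub>i \<noteq> w\<^sub>i\<close> has to be achieved. Let the side of \<open>u\<close> have \<open>a\<close> vertices,
  with \<open>u = 0\<close>, and split the other side into \<open>s\<close> pairs \<open>{2p, 2p + 1}\<close>. Each pair spans
  together with the first side a \<open>K\<^bsub>a,2\<^esub>\<close>, in which the two vertices of the pair are used
  alternately. The first circuit runs through these \<open>K\<^bsub>a,2\<^esub>\<close> one after the other, always
  from \<open>0\<close> to \<open>0\<close>. The second one goes from \<open>0\<close> to \<open>a - 1\<close> via pair \<open>0\<close>, runs through the
  other \<open>K\<^bsub>a,2\<^esub>\<close> from \<open>a - 1\<close> to \<open>a - 1\<close>, and then completes pair \<open>0\<close>. This shifts the
  visits of \<open>0\<close>, and the order of the other vertices can be chosen such that the circuits never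
  meet on the first side. On the second side they alternate with opposite parities.
\<close>

section \<open>Alternating vertex sequences and their edges\<close>

lemma walk_edges_map_upt:
  "walk_edges (map f [0..<Suc n]) = map (\<lambda>k. {f k, f (Suc k)}) [0..<n]"
  unfolding walk_edges_def by (rule nth_equalityI) (auto simp: nth_tl simp del: upt_Suc)

definition zigzag :: "(nat \<Rightarrow> 'a) \<Rightarrow> (nat \<Rightarrow> 'a) \<Rightarrow> nat \<Rightarrow> 'a list" where
  "zigzag f g n = map (\<lambda>k. if even k then f (k div 2) else g (k div 2)) [0..<Suc (2 * n)]"

lemma nth_zigzag:
  "k \<le> 2 * n \<Longrightarrow> zigzag f g n ! k = (if even k then f (k div 2) else g (k div 2))"
  unfolding zigzag_def by (subst nth_map) (auto simp del: upt_Suc)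

lemma length_zigzag [simp]: "length (zigzag f g n) = Suc (2 * n)"
  by (simp add: zigzag_def)

lemma zigzag_not_Nil [simp]: "zigzag f g n \<noteq> []"
  using length_zigzag[of f g n] by fastforce

lemma hd_zigzag [simp]: "hd (zigzag f g n) = f 0"
  by (simp add: hd_conv_nth nth_zigzag)

lemma last_zigzag [simp]: "last (zigzag f g n) = f n"
  by (simp add: last_conv_nth nth_zigzag)

lemma set_zigzag: "set (zigzag f g n) \<subseteq> f ` {..n} \<union> g ` {..<n}"
  by (auto simp: zigzag_def simp del: upt_Suc elim!: oddE)

lemma length_walk_edges_zigzag: "length (walk_edges (zigzag f g n)) = 2 * n"
  unfolding zigzag_def walk_edges_map_upt by simp

lemma set_walk_edges_zigzag:
  "set (walk_edges (zigzag f g n)) = (\<Union>k<n. {{f k, g k}, {f (Suc k), g k}})"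
proof -
  have "(\<lambda>k. {if even k then f (k div 2) else g (k div 2),
                if even (Suc k) then f (Suc k div 2) else g (Suc k div 2)}) ` {..<2 * n}
      = (\<Union>k<n. {{f k, g k}, {f (Suc k), g k}})" (is "?h ` _ = ?U")
  proof
    show "?h ` {..<2 * n} \<subseteq> ?U"
    proof
      fix e assume "e \<in> ?h ` {..<2 * n}"
      then obtain k where k: "k < 2 * n" "e = ?h k" by blast
      show "e \<in> ?U"
        by (rule UN_I[of "k div 2"]) (use k in \<open>auto elim!: evenE oddE simp: insert_commute\<close>)
    qed
    have "{f k, g k} \<in> ?h ` {..<2 * n}" "{f (Suc k), g k} \<in> ?h ` {..<2 * n}" if "k < n" for k
      using that by (auto intro: image_eqI[of _ _ "2 * k"] image_eqI[of _ _ "Suc (2 * k)"])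
    then show "?U \<subseteq> ?h ` {..<2 * n}" by blast
  qed
  then show ?thesis
    unfolding zigzag_def walk_edges_map_upt by (simp add: atLeast0LessThan del: upt_Suc)
qed

section \<open>Eulerian circuits in a labelled complete bipartite graph\<close>

locale bipartition_labelling =
  fixes G :: "'a graph" and L R :: "nat \<Rightarrow> 'a" and a b :: nat
  assumes verts: "verts G = L ` {..<a} \<union> R ` {..<b}"
    and edges: "edges G = {{L i, R j} | i j. i < a \<and> j < b}"
    and inj_L: "inj_on L {..<a}" and inj_R: "inj_on R {..<b}"
    and disjoint: "L i \<noteq> R j"
begin

lemma card_edges: "card (edges G) = a * b"
proof -
  have "edges G = (\<lambda>(i, j). {L i, R j}) ` ({..<a} \<times> {..<b})"
    unfolding edges by auto
  moreover have "inj_on (\<lambda>(i, j). {L i, R j}) ({..<a} \<times> {..<b})"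
    using inj_L inj_R disjoint unfolding inj_on_def
    by (simp add: doubleton_eq_iff)
  ultimately show ?thesis by (simp add: card_image)
qed

lemma finite_simple: "finite_simple_graph G"
  unfolding finite_simple_graph_def verts edges using disjoint by (auto simp: card_2_iff)

lemma not_adjacent_L: "\<not> adjacent G (L i) (L j)"
proof -
  have "R k \<notin> {L i, L j}" for k
    using disjoint[of _ k] by (metis insertE singletonD)
  then show ?thesis unfolding adjacent_def edges by blast
qed

lemma not_adjacent_R: "\<not> adjacent G (R i) (R j)"
proof -
  have "L k \<notin> {R i, R j}" for k
    using disjoint[of k] by blast
  then show ?thesis unfolding adjacent_def edges by blast
qed

text \<open>A walk of length \<open>a * b\<close> that covers all edges covers none of them twice.\<close>

lemma eulerian_circuit_zigzag:
  assumes n: "2 * n = a * b"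
    and X: "\<And>k. k \<le> n \<Longrightarrow> X k < a" and Y: "\<And>k. k < n \<Longrightarrow> Y k < b"
    and closed: "X n = X 0"
    and cover: "\<And>i j. i < a \<Longrightarrow> j < b \<Longrightarrow> \<exists>k<n. Y k = j \<and> (X k = i \<or> X (Suc k) = i)"
  shows "eulerian_circuit G (zigzag (L \<circ> X) (R \<circ> Y) n)" (is "eulerian_circuit G ?z")
proof -
  have set_edges: "set (walk_edges ?z) = edges G"
  proof
    have "\<exists>i j. {L (X k'), R (Y k)} = {L i, R j} \<and> i < a \<and> j < b" if "k < n" "k' \<le> n" for k k'
      using X[of k'] Y[of k] that by blast
    then show "set (walk_edges ?z) \<subseteq> edges G"
      by (auto simp: set_walk_edges_zigzag edges)
    show "edges G \<subseteq> set (walk_edges ?z)"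
      unfolding set_walk_edges_zigzag edges using cover by fastforce
  qed
  have "distinct (walk_edges ?z)"
    by (rule card_distinct) (simp add: set_edges card_edges length_walk_edges_zigzag n)
  moreover have "set ?z \<subseteq> verts G"
    by (rule order_trans[OF set_zigzag]) (use X Y in \<open>auto simp: verts\<close>)
  ultimately show ?thesis
    by (simp add: eulerian_circuit_def closed_trail_def walk_def set_edges closed)
qed

text \<open>The parity of \<open>k + c\<close> selects one of the two members of pair
  \<open>P k\<close>. Two steps at \<open>i\<close> through the same pair with opposite parities
  therefore give both edges from \<open>i\<close> to that pair, whatever \<open>c\<close>
  is.\<close>

lemma eulerian_circuit_alternating:
  assumes b: "b = 2 * s" and n: "n = s * a"
    and X: "\<And>k. k \<le> n \<Longrightarrow> X k < a" and P: "\<And>k. k < n \<Longrightarrow> P k < s"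
    and closed: "X n = X 0"
    and cover: "\<And>i p. i < a \<Longrightarrow> p < s \<Longrightarrow>
      \<exists>k<n. \<exists>l<n. even k \<noteq> even l \<and> P k = p \<and> P l = p \<and> i \<in> {X k, X (Suc k)} \<inter> {X l, X (Suc l)}"
  shows "eulerian_circuit G (zigzag (L \<circ> X) (R \<circ> (\<lambda>k. 2 * P k + (k + c) mod 2)) n)"
proof (rule eulerian_circuit_zigzag)
  fix k assume "k < n"
  then show "2 * P k + (k + c) mod 2 < b"
    using P[of k] b mod_less_divisor[of 2 "k + c"] by linarith
next
  fix i j assume i: "i < a" and j: "j < b"
  have "j div 2 < s" using j b by simp
  from cover[OF i this] obtain k l where kl: "k < n" "l < n" "even k \<noteq> even l" "P k = j div 2" "P l = j div 2"
    "i \<in> {X k, X (Suc k)}" "i \<in> {X l, X (Suc l)}"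
    by blast
  then have "(k + c) mod 2 = j mod 2 \<or> (l + c) mod 2 = j mod 2"
    by presburger
  moreover have "2 * P k + j mod 2 = j" "2 * P l + j mod 2 = j"
    using kl by simp_all
  ultimately show "\<exists>k<n. 2 * P k + (k + c) mod 2 = j \<and> (X k = i \<or> X (Suc k) = i)"
    using kl by (metis insert_iff singletonD)
qed (use assms in auto)

end

section \<open>The two visiting orders on the first side\<close>

context
  fixes a s :: nat
  assumes a: "even a" "4 \<le> a" and s: "0 < s"
begin

lemma block_less: "q < s \<Longrightarrow> t < a \<Longrightarrow> q * a + t < s * a"
proof -
  assume "q < s" "t < a"
  then have "q * a + t < Suc q * a" "Suc q * a \<le> s * a"
    by (simp, intro mult_le_mono1, simp)
  then show ?thesis by linarith
qed

text \<open>In block \<open>p\<close>, step \<open>p * a + i\<close> leaves \<open>i\<close> and the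
  cyclically preceding step of the block enters it. These have opposite parities even for
  \<open>i = 0\<close>, because \<open>a\<close> is even.\<close>

lemma cover_sequential:
  assumes "i < a" and "p < s"
  shows "\<exists>k < s * a. \<exists>l < s * a. even k \<noteq> even l \<and> k div a = p \<and> l div a = p \<and>
    i \<in> {k mod a, Suc k mod a} \<inter> {l mod a, Suc l mod a}"
proof -
  have blk: "(p * a + t) div a = p" "(p * a + t) mod a = t" "p * a + t < s * a"
      "even (p * a + t) = even t" if "t < a" for t
    using that a block_less[of p t] assms by auto
  define t where "t = (if i = 0 then a - 1 else i - 1)"
  have t: "t < a" "even t \<noteq> even i" using a assms by (auto simp: t_def)
  have "Suc (p * a + t) mod a = i"
  proof (cases "i = 0")
    case True
    then have "Suc (p * a + t) = Suc p * a" using a by (simp add: t_def)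
    then show ?thesis using True by (metis mod_mult_self2_is_0)
  next
    case False
    then have "Suc (p * a + t) = p * a + i" by (simp add: t_def)
    then show ?thesis using blk(2)[of i] assms by metis
  qed
  then show ?thesis
    using t blk[of t] blk[of i] assms
    by (intro exI[of _ "p * a + i"] conjI exI[of _ "p * a + t"]) auto
qed

text \<open>After the initial \<open>0\<close>, the sequence repeats
  \<open>a - 1, 0, 2, ..., a - 2, 1\<close>. In the last round \<open>0\<close> and \<open>1\<close>
  trade places, so that the walk closes at \<open>0\<close>.\<close>

definition nested :: "nat \<Rightarrow> nat" where
  "nested k = (let t = k mod a in
     if t = 0 then (if k = 0 \<or> k = s * a then 0 else 1)
     else if t = 1 then a - 1
     else if t = 2 then (if k < (s - 1) * a then 0 else 1)
     else t - 1)"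

text \<open>This is the ceiling of \<open>k / a\<close>, modulo \<open>s\<close>: the pair changes
  at the visits of \<open>a - 1\<close>, which occur at \<open>k mod a = 1\<close>. Pair
  \<open>0\<close> gets step \<open>0\<close> and the last \<open>a - 1\<close> steps.\<close>

definition nested_pair :: "nat \<Rightarrow> nat" where
  "nested_pair k = (k + a - 1) div a mod s"

lemma nested_less: "nested k < a"
  using a by (auto simp: nested_def Let_def less_imp_diff_less)

lemma nested_neq: "0 < k \<Longrightarrow> k < s * a \<Longrightarrow> nested k \<noteq> k mod a"
  using a by (auto simp: nested_def Let_def)

lemma nested_block:
  assumes "t < a"
  shows "nested (q * a + t) =
     (if t = 0 then (if q = 0 \<or> q = s then 0 else 1)
      else if t = 1 then a - 1
      else if t = 2 then (if q < s - 1 then 0 else 1)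
      else t - 1)"
proof -
  have "(q * a + t < (s - 1) * a) = (q < s - 1)"
  proof
    assume "q * a + t < (s - 1) * a"
    then have "q * a < (s - 1) * a" by linarith
    then show "q < s - 1" by simp
  next
    assume "q < s - 1"
    then have "Suc q * a \<le> (s - 1) * a" by (intro mult_le_mono1) simp
    then show "q * a + t < (s - 1) * a" using assms by simp
  qed
  then show ?thesis using assms a by (auto simp: nested_def Let_def)
qed

lemma nested_pair_block:
  assumes "0 < t" "t \<le> a"
  shows "nested_pair (q * a + t) = Suc q mod s"
proof -
  have "q * a + t + a - 1 = Suc q * a + (t - 1)" using assms by simp
  moreover have "(Suc q * a + (t - 1)) div a = Suc q" using assms a by (subst div_mult_self3) auto
  ultimately show ?thesis by (simp add: nested_pair_def)
qed

lemma nested_pair_0: "nested_pair 0 = 0"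
  using a by (simp add: nested_pair_def)

lemma cover_nested:
  assumes "i < a" and "p < s"
  shows "\<exists>k < s * a. \<exists>l < s * a. even k \<noteq> even l \<and> nested_pair k = p \<and> nested_pair l = p \<and>
    i \<in> {nested k, nested (Suc k)} \<inter> {nested l, nested (Suc l)}" (is ?thesis)
proof -
  \<comment> \<open>The run through pair \<open>p\<close> starts at step \<open>q * a + 1\<close>;
    the last block returns to pair \<open>0\<close>.\<close>
  define q where "q = (if p = 0 then s else p) - 1"
  have q: "q < s" "Suc q mod s = p" "p = 0 \<longleftrightarrow> q = s - 1"
    using assms s by (auto simp: q_def)
  \<comment> \<open>A visit of \<open>i\<close> inside the run supplies both steps at once, the
    entering and the leaving one, which are consecutive.\<close>
  have inner: ?thesis if "0 < t" "t < a" "nested (Suc (q * a + t)) = i" "Suc (q * a + t) < s * a" for t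
    using that a q nested_pair_block[of t q] nested_pair_block[of "Suc t" q]
    by (intro exI[of _ "q * a + t"] conjI exI[of _ "Suc (q * a + t)"]) auto
  have first: "nested (q * a + 1) = a - 1" "nested_pair (q * a + 1) = p" "q * a + 1 < s * a"
    using nested_block[of 1 q] nested_pair_block[of 1 q] a q block_less[of q 1] by auto
  consider (pivot) "i = a - 1" | (one_end) "i = 1" "p = 0" | (zero_end) "i = 0" "p = 0"
    | (one_mid) "i = 1" "p \<noteq> 0" | (zero_mid) "i = 0" "p \<noteq> 0" | (other) "2 \<le> i" "i < a - 1"
    using assms by linarith
  then show ?thesis
  proof cases
    case pivot
    \<comment> \<open>The run leaves \<open>a - 1\<close> at step \<open>q * a + 1\<close>. Step
      \<open>k\<close> enters it: the final step of the run, or the isolated step \<open>0\<close>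
      for pair \<open>0\<close>.\<close>
    define k where "k = (if p = 0 then 0 else Suc q * a)"
    have "k < s * a"
      using q a s block_less[of "Suc q" 0] by (auto simp: k_def)
    moreover have "nested (Suc k) = a - 1"
      using nested_block[of 1 0] nested_block[of 1 "Suc q"] a by (simp add: k_def)
    moreover have "nested_pair k = p"
      using nested_pair_block[of a q] nested_pair_0 a q by (auto simp: k_def add.commute)
    moreover have "even k" using a by (simp add: k_def)
    ultimately show ?thesis using first a pivot
      by (intro exI[of _ k] conjI exI[of _ "q * a + 1"]) auto
  next
    case one_end
    then show ?thesis using inner[of 1] nested_block[of 2 q] block_less[of q 2] a q by auto
  next
    case zero_end
    \<comment> \<open>For pair \<open>0\<close>, vertex \<open>0\<close> is met by the first step of
      the whole circuit and by its last step \<open>l\<close>.\<close>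
    define l where "l = q * a + (a - 1)"
    have "Suc l = s * a" using a q zero_end s by (cases s) (auto simp: l_def)
    then have "nested (Suc l) = 0" "l < s * a" "odd l"
      using nested_block[of 0 s] a by (auto, metis even_Suc even_mult_iff)
    moreover have "nested_pair l = p" using nested_pair_block[of "a - 1" q] a q by (simp add: l_def)
    ultimately show ?thesis
      using zero_end nested_pair_0 nested_block[of 0 0] a s by (intro exI[of _ 0] exI[of _ l]) auto
  next
    case one_mid
    then have "Suc q < s" using q by linarith
    moreover have "Suc (q * a + (a - 1)) = Suc q * a" using a by simp
    ultimately show ?thesis
      using inner[of "a - 1"] nested_block[of 0 "Suc q"] block_less[of "Suc q" 0] a one_mid by (simp add: add.commute)
  next
    case zero_mid
    then show ?thesis using inner[of 1] nested_block[of 2 q] block_less[of q 2] a q by auto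
  next
    case other
    then show ?thesis
      using inner[of i] nested_block[of "Suc i" q] block_less[of q "Suc i"] a q by auto
  qed
qed

lemma nested_ends: "nested 0 = 0" "nested (s * a) = 0"
  using a by (auto simp: nested_def)

end

section \<open>Avoiding circuits at every vertex\<close>

context bipartition_labelling
begin

text \<open>Permuting labels on the first side allows any of its vertices to serve as the base
  \<open>L 0\<close>.\<close>

lemma relabel:
  assumes "bij_betw f {..<a} {..<a}"
  shows "bipartition_labelling G (L \<circ> f) R a b"
proof
  have im: "(L \<circ> f) ` {..<a} = L ` {..<a}"
    using assms by (simp add: bij_betw_def flip: image_image)
  have edges_image: "{{g i, R j} | i j. i < a \<and> j < b} = (\<lambda>(x, y). {x, y}) ` (g ` {..<a} \<times> R ` {..<b})"
    for g by (auto simp: image_iff)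
  show "edges G = {{(L \<circ> f) i, R j} | i j. i < a \<and> j < b}"
    unfolding edges edges_image im ..
  show "verts G = (L \<circ> f) ` {..<a} \<union> R ` {..<b}"
    unfolding im verts ..
  show "inj_on (L \<circ> f) {..<a}"
    using assms inj_L by (simp add: bij_betw_def comp_inj_on)
qed (use inj_R disjoint in auto)

lemma swap_sides: "bipartition_labelling G R L b a"
  by unfold_locales
    (use verts edges inj_L inj_R disjoint in \<open>auto simp: insert_commute, metis\<close>)

lemma ex_avoiding:
  assumes a: "even a" "4 \<le> a" and b: "even b" "0 < b"
  shows "\<exists>xs ys. avoiding G (L 0) xs ys"
proof -
  define s where "s = b div 2"
  have s: "0 < s" "b = 2 * s" using b by (auto simp: s_def)
  note ctx = a s(1)
  \<comment> \<open>The term \<open>k + 0\<close> matches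
    \<open>eulerian_circuit_alternating\<close> with \<open>c = 0\<close>; \<open>ys\<close> takes
    \<open>c = 1\<close>.\<close>
  define xs where "xs = zigzag (L \<circ> (\<lambda>k. k mod a)) (R \<circ> (\<lambda>k. 2 * (k div a) + (k + 0) mod 2)) (s * a)"
  define ys where "ys = zigzag (L \<circ> nested a s)
    (R \<circ> (\<lambda>k. 2 * nested_pair a s k + (k + 1) mod 2)) (s * a)"
  have P: "k div a < s" if "k < s * a" for k
    using that by (simp add: less_mult_imp_div_less)
  have P': "nested_pair a s k < s" for k
    using s by (simp add: nested_pair_def[OF ctx])
  have xs: "eulerian_circuit G xs" unfolding xs_def
    using a s by (intro eulerian_circuit_alternating[of s] P cover_sequential[OF ctx])
      auto
  have ys: "eulerian_circuit G ys" unfolding ys_def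
    using a s by (intro eulerian_circuit_alternating[of s] P' cover_nested[OF ctx] nested_less[OF ctx])
      (auto simp: nested_ends[OF ctx])
  have "xs ! i \<noteq> ys ! i \<and> \<not> adjacent G (xs ! i) (ys ! i)"
    if "1 \<le> i" "i \<le> card (edges G) - 1" for i
  proof -
    define k where "k = i div 2"
    have "a * b = 2 * (s * a)" using s by simp
    then have i: "0 < i" "i < 2 * (s * a)" using that unfolding card_edges by linarith+
    show ?thesis
    proof (cases "even i")
      case True
      \<comment> \<open>Excluded are just the two ends, where both circuits are at the base.\<close>
      then have k: "0 < k" "k < s * a" using i by (auto simp: k_def elim!: evenE)
      have "L (k mod a) \<noteq> L (nested a s k)"
        using nested_neq[OF ctx k] nested_less[OF ctx, of k] a inj_onD[OF inj_L, of "k mod a"]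
        by (metis lessThan_iff mod_less_divisor not_numeral_le_zero gr0I)
      then show ?thesis using True i by (simp add: xs_def ys_def nth_zigzag k_def not_adjacent_L)
    next
      case False
      then have k: "k < s * a" using i by (auto simp: k_def elim!: oddE)
      let ?y = "2 * (k div a) + k mod 2" and ?y' = "2 * nested_pair a s k + Suc k mod 2"
      have "?y < b" "?y' < b" using P[OF k] P'[of k] s by linarith+
      moreover have "2 * p + k mod 2 \<noteq> 2 * q + Suc k mod 2" for p q :: nat by presburger
      ultimately have "R ?y \<noteq> R ?y'" using inj_onD[OF inj_R] by blast
      then show ?thesis using False i by (simp add: xs_def ys_def nth_zigzag k_def not_adjacent_R)
    qed
  qed
  moreover have "hd xs = L 0" "hd ys = L 0"
    by (simp_all add: xs_def ys_def nested_ends[OF ctx])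
  ultimately show ?thesis using xs ys unfolding avoiding_def by blast
qed

lemma ex_avoiding_at:
  assumes "even a" "4 \<le> a" "even b" "0 < b" "u < a"
  shows "\<exists>xs ys. avoiding G (L u) xs ys"
proof -
  have "bij_betw (transpose 0 u) {..<a} {..<a}"
    using assms by (auto simp: transpose_def bij_betw_def inj_on_def image_iff split: if_splits)
  from bipartition_labelling.ex_avoiding[OF relabel[OF this]] show ?thesis
    using assms by simp
qed

end

lemma bipartition_labelling_complete_bipartite:
  "bipartition_labelling (complete_bipartite m n) Inl Inr m n"
  by unfold_locales (auto simp: complete_bipartite_def)

theorem theorem5:
  fixes r s :: nat
  assumes "r \<ge> 2" and "s \<ge> 2"
  shows "doubly_eulerian (complete_bipartite (2 * r) (2 * s))"
proof -
  let ?G = "complete_bipartite (2 * r) (2 * s)"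
  interpret lab: bipartition_labelling ?G Inl Inr "2 * r" "2 * s"
    by (rule bipartition_labelling_complete_bipartite)
  have avoid: "\<exists>xs ys. avoiding ?G u xs ys" if "u \<in> verts ?G" for u
  proof -
    from that consider i where "u = Inl i" "i < 2 * r" | j where "u = Inr j" "j < 2 * s"
      by (auto simp: complete_bipartite_def)
    then show ?thesis
    proof cases
      case 1
      then show ?thesis using lab.ex_avoiding_at assms by simp
    next
      \<comment> \<open>With the sides exchanged, it is \<open>2 * s\<close> that has to be at least
        4.\<close>
      case 2
      then show ?thesis using bipartition_labelling.ex_avoiding_at[OF lab.swap_sides] assms by simp
    qed
  qed
  have "Inl 0 \<in> verts ?G" using assms by (simp add: complete_bipartite_def)
  then have "\<exists>xs. eulerian_circuit ?G xs" using avoid unfolding avoiding_def by blast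
  then show ?thesis using avoid lab.finite_simple by (simp add: doubly_eulerian_def eulerian_def)
qed

end
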